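(* Let $n\ge 2$, let $\rho$ be a real-analytic function on an open set $\widetilde\Omega\subset\mathbb{R}^{2n}$, let $\mathcal{A}=(\alpha_{j,i})_{1\le j,i\le 2n}$ be a real $2n\times 2n$ matrix whose entries are real-analytic functions on $\widetilde\Omega$, and let $m=(x_1,x_2,f_1,\dots,f_{2n},p^3_1,\dots,p^{2n}_1)$ be a point of $M$ at which $D\neq0$. With $D$, $\mathfrak{D}_0$, $\gamma^1_i,\gamma^2_i$, the torsion coefficients $c^k_{1,2}$ and the notion "the torsion can be absorbed" as defined in the context, the following hold at $m$. (i) If $\mathfrak{D}_0\neq 0$, the torsion can be absorbed if $$\rho_1\Big[c^1_{1,2}-\sum_{i=3}^{2n}\gamma^1_i c^i_{1,2}\Big]=\rho_2\Big[c^2_{1,2}-\sum_{i=3}^{2n}\gamma^2_i c^i_{1,2}\Big].$$ (ii) If $\mathfrak{D}_0=0$, the torsion can be absorbed if $$c^1_{1,2}=\sum_{i=3}^{2n}\gamma^1_ic^i_{1,2}\quad\text{and}\quad c^2_{1,2}=\sum_{i=3}^{2n}\gamma^2_ic^i_{1,2}.$$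
   Context: The problem behind these objects is the PDE system $\rho(f(x))=0$, $\partial f/\partial x_2=\mathcal{A}(f)\,\partial f/\partial x_1$ for maps $f$ from an open set $\Omega\subset\mathbb{R}^2$ to $\widetilde\Omega$. Functions on $\widetilde\Omega$ are evaluated at $f=(f_1,\dots,f_{2n})$. Write $\rho_j=\partial\rho/\partial y_j$, let $\alpha^{(2)}_{j,i}$ be the entries of $\mathcal{A}^2$, and for $1\le i\le 2n$ put $$\mu_i=\sum_{j=1}^{2n}\rho_j\alpha_{j,i},\qquad \mu^{(2)}_i=\sum_{j=1}^{2n}\rho_j\alpha^{(2)}_{j,i}.$$ Put $D=\rho_1\mu_2-\rho_2\mu_1$, assumed nonzero. For $3\le i\le 2n$ and $1\le j\le 2n$ put $$\gamma^1_i=-\tfrac1D(\rho_i\mu_2-\rho_2\mu_i),\qquad \gamma^2_i=-\tfrac1D(\rho_1\mu_i-\rho_i\mu_1),\qquad \beta_{j,i}=\alpha_{j,1}\gamma^1_i+\alpha_{j,2}\gamma^2_i+\alpha_{j,i}.$$ Let $\mathfrak{D}_0=(\mathfrak{D}_{0,3},\dots,\mathfrak{D}_{0,2n})$ be the row vector with $$\mathfrak{D}_{0,i}=-\frac1{D^2}\Big\{\rho_1\big[\mu_i\mu^{(2)}_2-\mu_2\mu^{(2)}_i\big]+\rho_2\big[\mu_1\mu^{(2)}_i-\mu_i\mu^{(2)}_1\big]+\rho_i\big[\mu_2\mu^{(2)}_1-\mu_1\mu^{(2)}_2\big]\Big\}.$$ Let $M$ be the space with coordinates $(x_1,x_2,f_1,\dots,f_{2n},p^3_1,\dots,p^{2n}_1)$,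 with $(x_1,x_2)\in\Omega$, $f\in\widetilde\Omega$ and $p^j_1\in\mathbb{R}$ (where $D\ne0$). On $M$ consider the 1-forms $$\theta^1=df_1-\sum_{j=3}^{2n}\gamma^1_jp^j_1dx_1-\sum_{j=3}^{2n}\beta_{1,j}p^j_1dx_2,\qquad \theta^2=df_2-\sum_{j=3}^{2n}\gamma^2_jp^j_1dx_1-\sum_{j=3}^{2n}\beta_{2,j}p^j_1dx_2,$$ $$\theta^i=df_i-p^i_1dx_1-\sum_{j=3}^{2n}\beta_{i,j}p^j_1dx_2\qquad(3\le i\le 2n).$$ Modulo the algebraic ideal generated by $\theta^1,\dots,\theta^{2n}$, each $d\theta^k$ is uniquely a combination of the forms $dp^j_1\wedge dx_1$, $dp^j_1\wedge dx_2$ ($3\le j\le 2n$) and $dx_1\wedge dx_2$; $c^k_{1,2}$ denotes the coefficient of $dx_1\wedge dx_2$, for $1\le k\le 2n$. The torsion can be absorbed (vanishes) at a point of $M$ if there exist real numbers $v^i_1,v^i_2$ ($3\le i\le 2n$) such that at that point $$\sum_{i=3}^{2n}\big(\gamma^1_iv^i_2-\beta_{1,i}v^i_1\big)=c^1_{1,2},\qquad \sum_{i=3}^{2n}\big(\gamma^2_iv^i_2-\beta_{2,i}v^i_1\big)=c^2_{1,2},\qquad v^j_2-\sum_{i=3}^{2n}\beta_{j,i}v^i_1=c^j_{1,2}\quad(3\le j\le 2n).$$ *)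

theory Defs
  imports "HOL-Analysis.Analysis"
begin

text \<open>
  The library has no real-analytic functions of several real variables: \<open>g\<close> is real-analytic
  on \<open>S\<close> if around every point of \<open>S\<close> it is the sum of a convergent multivariate power series;
  \<open>\<kappa>\<close> ranges over the multi-indices.
\<close>

definition real_analytic_on :: "(real ^ 'm \<Rightarrow> real) \<Rightarrow> (real ^ 'm) set \<Rightarrow> bool" where
  "real_analytic_on g S \<longleftrightarrow>
     (\<forall>a\<in>S. \<exists>r>0. ball a r \<subseteq> S \<and>
        (\<exists>c :: ('m \<Rightarrow> nat) \<Rightarrow> real. \<forall>y\<in>ball a r.
           ((\<lambda>\<kappa>. c \<kappa> * (\<Prod>i\<in>UNIV. (y $ i - a $ i) ^ \<kappa> i)) has_sum g y) UNIV))"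

definition partial_deriv :: "'m \<Rightarrow> (real ^ 'm \<Rightarrow> real) \<Rightarrow> real ^ 'm \<Rightarrow> real" where
  "partial_deriv j g y = deriv (\<lambda>t. g (y + t *\<^sub>R axis j 1)) 0"


text \<open>
  Differential forms on a Euclidean space: a 1-form sends a point to a linear functional, a 2-form
  at a point is an alternating bilinear function of two tangent vectors, and the wedge product is
  normalised without the factor \<open>1/2\<close>, so that \<open>d (g dh) = dg \<and> dh\<close>.
\<close>

definition wedge :: "('a \<Rightarrow> real) \<Rightarrow> ('a \<Rightarrow> real) \<Rightarrow> 'a \<Rightarrow> 'a \<Rightarrow> real" where
  "wedge \<phi> \<psi> u v = \<phi> u * \<psi> v - \<phi> v * \<psi> u"

definition ext_deriv :: "('a::euclidean_space \<Rightarrow> 'a \<Rightarrow> real) \<Rightarrow> 'a \<Rightarrow> 'a \<Rightarrow> 'a \<Rightarrow> real" where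
  "ext_deriv \<omega> z u v =
     frechet_derivative (\<lambda>w. \<omega> w v) (at z) u - frechet_derivative (\<lambda>w. \<omega> w u) (at z) v"

text \<open>
  Congruence of 2-forms at a point modulo the algebraic ideal generated by the 1-forms \<open>\<Theta> k\<close>: the
  degree 2 part of that ideal consists of the sums \<open>\<Sum>k. \<eta> k \<and> \<Theta> k\<close> with arbitrary 1-forms \<open>\<eta> k\<close>.
\<close>

definition cong_mod_ideal ::
  "('k::finite \<Rightarrow> 'a::euclidean_space \<Rightarrow> real) \<Rightarrow> ('a \<Rightarrow> 'a \<Rightarrow> real) \<Rightarrow> ('a \<Rightarrow> 'a \<Rightarrow> real) \<Rightarrow> bool" where
  "cong_mod_ideal \<Theta> \<Phi> \<Psi> \<longleftrightarrow>
     (\<exists>\<eta>. (\<forall>k. linear (\<eta> k)) \<and> (\<forall>u v. \<Phi> u v - \<Psi> u v = (\<Sum>k\<in>UNIV. wedge (\<eta> k) (\<Theta> k) u v)))"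


text \<open>
  The indices \<open>1, \<dots>, 2n\<close> form the type \<open>2 + 'q\<close>, where \<open>'q\<close> stands for the indices \<open>3, \<dots>, 2n\<close>;
  thus \<open>CARD('q) + 2 = 2 * n\<close>. A point of \<open>M\<close> is a triple \<open>(x, f, p)\<close> with \<open>p $ j\<close>
  the coordinate \<open>p\<^sup>j\<^sub>1\<close>; tangent vectors have the same type.
\<close>

abbreviation i1 :: "2 + 'q" where "i1 \<equiv> Inl 1"
abbreviation i2 :: "2 + 'q" where "i2 \<equiv> Inl 2"

type_synonym 'q jet = "(real ^ 2) \<times> (real ^ (2 + 'q)) \<times> (real ^ 'q)"

definition dx :: "2 \<Rightarrow> 'q::finite jet \<Rightarrow> real" where
  "dx a u = fst u $ a"

definition df :: "2 + 'q \<Rightarrow> 'q::finite jet \<Rightarrow> real" where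
  "df k u = fst (snd u) $ k"

definition dp :: "'q \<Rightarrow> 'q::finite jet \<Rightarrow> real" where
  "dp j u = snd (snd u) $ j"


text \<open>The entry \<open>\<alpha>\<^sub>j\<^sub>,\<^sub>i\<close> of the matrix at \<open>y\<close> is \<open>A y $ j $ i\<close>.\<close>

context
  fixes \<rho> :: "real ^ (2 + 'q::finite) \<Rightarrow> real"
    and A :: "real ^ (2 + 'q) \<Rightarrow> real ^ (2 + 'q) ^ (2 + 'q)"
begin

definition rho_d :: "2 + 'q \<Rightarrow> real ^ (2 + 'q) \<Rightarrow> real" where
  "rho_d j y = partial_deriv j \<rho> y"

definition mu :: "2 + 'q \<Rightarrow> real ^ (2 + 'q) \<Rightarrow> real" where
  "mu i y = (\<Sum>j\<in>UNIV. rho_d j y * A y $ j $ i)"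

definition mu2 :: "2 + 'q \<Rightarrow> real ^ (2 + 'q) \<Rightarrow> real" where
  "mu2 i y = (\<Sum>j\<in>UNIV. rho_d j y * (A y ** A y) $ j $ i)"

definition D :: "real ^ (2 + 'q) \<Rightarrow> real" where
  "D y = rho_d i1 y * mu i2 y - rho_d i2 y * mu i1 y"

definition gamma1 :: "'q \<Rightarrow> real ^ (2 + 'q) \<Rightarrow> real" where
  "gamma1 i y = - (1 / D y) * (rho_d (Inr i) y * mu i2 y - rho_d i2 y * mu (Inr i) y)"

definition gamma2 :: "'q \<Rightarrow> real ^ (2 + 'q) \<Rightarrow> real" where
  "gamma2 i y = - (1 / D y) * (rho_d i1 y * mu (Inr i) y - rho_d (Inr i) y * mu i1 y)"

definition beta :: "2 + 'q \<Rightarrow> 'q \<Rightarrow> real ^ (2 + 'q) \<Rightarrow> real" where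
  "beta j i y = A y $ j $ i1 * gamma1 i y + A y $ j $ i2 * gamma2 i y + A y $ j $ Inr i"

definition D0 :: "real ^ (2 + 'q) \<Rightarrow> real ^ 'q" where
  "D0 y = (\<chi> i. - (1 / (D y)\<^sup>2) *
     (rho_d i1 y * (mu (Inr i) y * mu2 i2 y - mu i2 y * mu2 (Inr i) y)
      + rho_d i2 y * (mu i1 y * mu2 (Inr i) y - mu (Inr i) y * mu2 i1 y)
      + rho_d (Inr i) y * (mu i2 y * mu2 i1 y - mu i1 y * mu2 i2 y)))"

definition M_space :: "(real ^ 2) set \<Rightarrow> (real ^ (2 + 'q)) set \<Rightarrow> 'q jet set" where
  "M_space \<Omega> \<Omega>t = {(x, f, p). x \<in> \<Omega> \<and> f \<in> \<Omega>t \<and> D f \<noteq> 0}"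

definition theta1 :: "'q jet \<Rightarrow> 'q jet \<Rightarrow> real" where
  "theta1 = (\<lambda>(x, f, p) u. df i1 u - (\<Sum>j\<in>UNIV. gamma1 j f * p $ j) * dx 1 u
     - (\<Sum>j\<in>UNIV. beta i1 j f * p $ j) * dx 2 u)"

definition theta2 :: "'q jet \<Rightarrow> 'q jet \<Rightarrow> real" where
  "theta2 = (\<lambda>(x, f, p) u. df i2 u - (\<Sum>j\<in>UNIV. gamma2 j f * p $ j) * dx 1 u
     - (\<Sum>j\<in>UNIV. beta i2 j f * p $ j) * dx 2 u)"

definition theta_rest :: "'q \<Rightarrow> 'q jet \<Rightarrow> 'q jet \<Rightarrow> real" where
  "theta_rest i = (\<lambda>(x, f, p) u. df (Inr i) u - p $ i * dx 1 u
     - (\<Sum>j\<in>UNIV. beta (Inr i) j f * p $ j) * dx 2 u)"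

definition theta :: "2 + 'q \<Rightarrow> 'q jet \<Rightarrow> 'q jet \<Rightarrow> real" where
  "theta k = (case k of Inl a \<Rightarrow> if a = 1 then theta1 else theta2 | Inr i \<Rightarrow> theta_rest i)"

text \<open>
  The torsion coefficient \<open>c\<^sup>k\<^sub>1\<^sub>,\<^sub>2\<close> at \<open>z\<close>. Working pointwise in the ideal loses nothing, because
  the forms \<open>dx\<close>, \<open>\<theta>\<close>, \<open>dp\<close> are a coframe at every point of \<open>M\<close>.
\<close>

definition torsion :: "2 + 'q \<Rightarrow> 'q jet \<Rightarrow> real" where
  "torsion k z = (THE c. \<exists>a b.
     cong_mod_ideal (\<lambda>l. theta l z) (ext_deriv (theta k) z)
       (\<lambda>u v. (\<Sum>j\<in>UNIV. a j * wedge (dp j) (dx 1) u v)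
            + (\<Sum>j\<in>UNIV. b j * wedge (dp j) (dx 2) u v)
            + c * wedge (dx 1) (dx 2) u v))"

definition torsion_absorbable :: "'q jet \<Rightarrow> bool" where
  "torsion_absorbable z \<longleftrightarrow> (let f = fst (snd z) in
     \<exists>v1 v2 :: 'q \<Rightarrow> real.
       (\<Sum>i\<in>UNIV. gamma1 i f * v2 i - beta i1 i f * v1 i) = torsion i1 z \<and>
       (\<Sum>i\<in>UNIV. gamma2 i f * v2 i - beta i2 i f * v1 i) = torsion i2 z \<and>
       (\<forall>j. v2 j - (\<Sum>i\<in>UNIV. beta (Inr j) i f * v1 i) = torsion (Inr j) z))"

end

end

theory Submission imports Defs begin

text \<open>
  For each \<open>j\<close> let \<open>w\<^sub>j\<close> be the vector with first two components \<open>\<gamma>\<^sup>1\<^sub>j\<close>, \<open>\<gamma>\<^sup>2\<^sub>j\<close> and remaining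
  components those of the \<open>j\<close>-th unit vector. By Cramer's rule the \<open>w\<^sub>j\<close> form a basis of the common
  kernel of the two row vectors \<open>\<nabla>\<rho>\<close> and \<open>\<mu> = \<nabla>\<rho> A\<close>, and \<open>\<beta>\<^sub>\<cdot>\<^sub>,\<^sub>j = A w\<^sub>j\<close>. Put
  \<open>P = \<Sum>j. p\<^sub>j w\<^sub>j\<close> and \<open>Q = A P\<close>; then \<open>\<theta>\<^sup>k = df\<^sub>k - P\<^sub>k dx\<^sub>1 - Q\<^sub>k dx\<^sub>2\<close>.

  \<^emph>\<open>The absorption equations.\<close> The equations with index at least 3 determine
  \<open>v\<^sub>2 = c + \<beta> v\<^sub>1\<close>. Substituted into the other two, they leave two equations for \<open>v\<^sub>1\<close>, with right-hand
  sides \<open>C\<^sub>a = c\<^sup>a - \<Sum>i. \<gamma>\<^sup>a\<^sub>i c\<^sup>i\<close>. Evaluating \<open>\<nabla>\<rho>\<close> and \<open>\<mu>\<close> on \<open>A w\<^sub>j\<close> gives \<open>0\<close> and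
  \<open>D D\<^sub>0\<^sub>j\<close>, so the left-hand sides are \<open>\<rho>\<^sub>2 (D\<^sub>0 \<bullet> v\<^sub>1)\<close> and \<open>- \<rho>\<^sub>1 (D\<^sub>0 \<bullet> v\<^sub>1)\<close>
  (\<open>beta_reduced\<close>). Hence if \<open>D\<^sub>0 = 0\<close> the system is solvable when \<open>C\<^sub>1 = C\<^sub>2 = 0\<close>, and if
  \<open>D\<^sub>0 \<noteq> 0\<close> it is solvable when \<open>(C\<^sub>1, C\<^sub>2)\<close> is a multiple of \<open>(\<rho>\<^sub>2, - \<rho>\<^sub>1)\<close>, that is, when
  \<open>\<rho>\<^sub>1 C\<^sub>1 + \<rho>\<^sub>2 C\<^sub>2 = 0\<close>.

  \<^emph>\<open>Where that relation comes from.\<close> Since \<open>\<nabla>\<rho>\<close> annihilates \<open>P\<close> and \<open>Q\<close>, the combination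
  \<open>\<Sum>k. \<rho>\<^sub>k \<theta>\<^sup>k\<close> is \<open>d\<rho>\<close>. As \<open>d\<rho>\<close> is closed, \<open>\<Sum>k. \<rho>\<^sub>k d\<theta>\<^sup>k\<close> lies in the ideal, so
  \<open>\<Sum>k. \<rho>\<^sub>k c\<^sup>k = 0\<close> (\<open>rho_torsion\<close>). Because \<open>\<nabla>\<rho>\<close> kills every \<open>w\<^sub>j\<close>, this sum is
  \<open>\<rho>\<^sub>1 C\<^sub>1 + \<rho>\<^sub>2 C\<^sub>2\<close> (\<open>pairing_of_annihilator\<close>). The proof below carries this out in components: the
  torsion is the bracket \<open>DP(Q) - DQ(P)\<close> in the variables \<open>f\<close> (\<open>torsion_eq_bracket\<close>), and closedness of
  \<open>d\<rho>\<close> is the symmetry of the second partial derivatives of \<open>\<rho>\<close>.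

  \<^emph>\<open>Regularity.\<close> The symmetry, and the differentiability of \<open>P\<close> and \<open>Q\<close>, are read off from
  the power series: these may be differentiated term by term, and the second derivatives of a
  monomial are visibly symmetric (\<open>real_analytic_has_derivative\<close>).
\<close>

section \<open>Term-by-term differentiation of multivariate power series\<close>

definition mono_at :: "real ^ 'm \<Rightarrow> ('m::finite \<Rightarrow> nat) \<Rightarrow> real ^ 'm \<Rightarrow> real" where
  "mono_at a e y = (\<Prod>i\<in>UNIV. (y $ i - a $ i) ^ e i)"

text \<open>
  Truncated subtraction is harmless here: \<open>lower j e\<close> only ever occurs next to the factor \<open>e j\<close>,
  which vanishes when there is no exponent to lower.
\<close>

definition lower :: "'m \<Rightarrow> ('m \<Rightarrow> nat) \<Rightarrow> 'm \<Rightarrow> nat" where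
  "lower j e = e(j := e j - 1)"

lemma has_derivative_mono_at:
  "(mono_at a e has_derivative (\<lambda>h. \<Sum>j\<in>UNIV. h $ j * (real (e j) * mono_at a (lower j e) y))) (at y)"
proof -
  have split: "mono_at a (lower j e) y
      = (y $ j - a $ j) ^ (e j - 1) * (\<Prod>i\<in>UNIV - {j}. (y $ i - a $ i) ^ e i)" for j
    unfolding mono_at_def lower_def
    by (subst prod.remove[of _ j]) (auto intro!: prod.cong)
  have "(mono_at a e has_derivative
      (\<lambda>h. \<Sum>j\<in>UNIV. (real (e j) * (h $ j * (y $ j - a $ j) ^ (e j - 1)))
        * (\<Prod>i\<in>UNIV - {j}. (y $ i - a $ i) ^ e i))) (at y)"
    unfolding mono_at_def[abs_def]
    by (rule has_derivative_prod)
      (auto intro!: derivative_eq_intros has_derivative_power bounded_linear.has_derivative[OF bounded_linear_vec_nth])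
  then show ?thesis
    by (simp add: split algebra_simps)
qed

lemma abs_mono_at_le:
  assumes "y \<in> ball a s"
  shows "\<bar>mono_at a e y\<bar> \<le> s ^ (\<Sum>i\<in>UNIV. e i)"
proof -
  have "\<bar>y $ i - a $ i\<bar> \<le> s" for i
    using component_le_norm_cart[of "y - a" i] assms by (simp add: dist_norm norm_minus_commute)
  then have "(\<Prod>i\<in>UNIV. \<bar>y $ i - a $ i\<bar> ^ e i) \<le> (\<Prod>i\<in>UNIV. s ^ e i)"
    by (intro prod_mono conjI power_mono) auto
  then show ?thesis
    by (simp add: mono_at_def abs_prod power_abs power_sum)
qed

text \<open>
  Differentiation multiplies a term of degree \<open>k\<close> by at most \<open>k\<close>; shrinking the radius from \<open>s\<close> to
  \<open>t\<close> compensates for this factor.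
\<close>

lemma geometric_absorbs_linear:
  fixes s t :: real
  assumes "0 < t" "t < s"
  obtains K where "\<And>k. real k * t ^ (k - 1) \<le> K * s ^ k"
proof -
  have "(\<lambda>k. real k * (t / s) ^ k) \<longlonglongrightarrow> 0"
    using assms by (intro powser_times_n_limit_0) auto
  then have "Bseq (\<lambda>k. real k * (t / s) ^ k)"
    by (rule convergent_imp_Bseq[OF convergentI])
  then obtain K where K: "\<And>k. \<bar>real k * (t / s) ^ k\<bar> \<le> K"
    by (auto simp: Bseq_def)
  have "real k * t ^ (k - 1) \<le> (K / t) * s ^ k" for k
  proof (cases k)
    case 0
    have "0 \<le> K" using K[of 0] by simp
    then show ?thesis using 0 assms by simp
  next
    case (Suc m)
    have "real k * (t / s) ^ k \<le> K" using K[of k] by (meson abs_le_D1)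
    then have "real k * t ^ k \<le> K * s ^ k"
      using assms by (simp add: power_divide field_simps)
    then show ?thesis using assms Suc by (simp add: field_simps)
  qed
  then show thesis by (rule that)
qed

text \<open>
  The differentiated series satisfies the hypothesis again, on a smaller radius, so that
  differentiation can be repeated. This is why the exponents are an arbitrary sequence \<open>e\<close> rather
  than an enumeration of all multi-indices: the differentiated series needs no reindexing.
\<close>

lemma summable_lower:
  fixes c :: "nat \<Rightarrow> real" and e :: "nat \<Rightarrow> 'm::finite \<Rightarrow> nat"
  assumes sum: "summable (\<lambda>k. \<bar>c k\<bar> * s ^ (\<Sum>i\<in>UNIV. e k i))" and t: "0 < t" "t < s"
  shows "summable (\<lambda>k. \<bar>c k * real (e k j)\<bar> * t ^ (\<Sum>i\<in>UNIV. lower j (e k) i))"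
proof -
  obtain K where K: "\<And>k. real k * t ^ (k - 1) \<le> K * s ^ k"
    using geometric_absorbs_linear[OF t] by blast
  have deg: "real (e k j) * t ^ (\<Sum>i\<in>UNIV. lower j (e k) i) \<le> K * s ^ (\<Sum>i\<in>UNIV. e k i)" for k
  proof (cases "e k j = 0")
    case True
    have "0 \<le> K" using K[of 0] by simp
    then show ?thesis using True t by simp
  next
    case False
    have "(\<Sum>i\<in>UNIV. e k i) = e k j + (\<Sum>i\<in>UNIV - {j}. e k i)"
      by (simp add: sum.remove[of _ j])
    moreover have "(\<Sum>i\<in>UNIV. lower j (e k) i) = (e k j - 1) + (\<Sum>i\<in>UNIV - {j}. e k i)"
      by (simp add: sum.remove[of _ j] lower_def)
    ultimately have eq: "(\<Sum>i\<in>UNIV. lower j (e k) i) = (\<Sum>i\<in>UNIV. e k i) - 1"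
      and le: "e k j \<le> (\<Sum>i\<in>UNIV. e k i)"
      using False by auto
    have "real (e k j) * t ^ (\<Sum>i\<in>UNIV. lower j (e k) i)
        \<le> real (\<Sum>i\<in>UNIV. e k i) * t ^ ((\<Sum>i\<in>UNIV. e k i) - 1)"
      unfolding eq using le t by (intro mult_right_mono) (auto simp del: of_nat_sum)
    then show ?thesis using K[of "\<Sum>i\<in>UNIV. e k i"] by linarith
  qed
  show ?thesis
  proof (rule summable_comparison_test')
    show "summable (\<lambda>k. K * (\<bar>c k\<bar> * s ^ (\<Sum>i\<in>UNIV. e k i)))"
      by (intro summable_mult sum)
    show "norm (\<bar>c k * real (e k j)\<bar> * t ^ (\<Sum>i\<in>UNIV. lower j (e k) i))
        \<le> K * (\<bar>c k\<bar> * s ^ (\<Sum>i\<in>UNIV. e k i))" for k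
      using mult_left_mono[OF deg, of "\<bar>c k\<bar>" k] t by (simp add: abs_mult mult_ac)
  qed
qed

text \<open>
  On the ball of radius \<open>t\<close> the differentiated series is dominated by the numerical series of
  \<open>summable_lower\<close>, hence converges uniformly, and a uniform limit of derivatives is the derivative
  of the limit.
\<close>

lemma monomial_series_has_derivative:
  fixes c :: "nat \<Rightarrow> real" and e :: "nat \<Rightarrow> 'm::finite \<Rightarrow> nat" and a :: "real ^ 'm"
  assumes sum: "summable (\<lambda>k. \<bar>c k\<bar> * s ^ (\<Sum>i\<in>UNIV. e k i))" and t: "0 < t" "t < s"
    and y: "y \<in> ball a t"
  shows "((\<lambda>y. \<Sum>k. c k * mono_at a (e k) y) has_derivative
      (\<lambda>h. \<Sum>j\<in>UNIV. h $ j * (\<Sum>k. (c k * real (e k j)) * mono_at a (lower j (e k)) y))) (at y)"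
proof -
  define d where "d k j y = (c k * real (e k j)) * mono_at a (lower j (e k)) y" for k j y
  have d_le: "norm (d k j y) \<le> \<bar>c k * real (e k j)\<bar> * t ^ (\<Sum>i\<in>UNIV. lower j (e k) i)"
    if "y \<in> ball a t" for k j y
    unfolding d_def using abs_mono_at_le[OF that, of "lower j (e k)"]
    by (simp add: abs_mult mult_left_mono)
  have unif: "uniform_limit (ball a t) (\<lambda>n y. \<Sum>k<n. d k j y) (\<lambda>y. \<Sum>k. d k j y) sequentially" for j
    by (rule Weierstrass_m_test[OF d_le summable_lower[OF sum t]])
  have summ: "summable (\<lambda>k. c k * mono_at a (e k) y)" if "y \<in> ball a t" for y
  proof (rule summable_comparison_test'[OF sum])
    have "y \<in> ball a s" using that t by auto
    from abs_mono_at_le[OF this]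
    show "norm (c k * mono_at a (e k) y) \<le> \<bar>c k\<bar> * s ^ (\<Sum>i\<in>UNIV. e k i)" for k
      by (simp add: abs_mult mult_left_mono)
  qed
  have "\<exists>g. \<forall>x\<in>ball a t. (\<lambda>k. c k * mono_at a (e k) x) sums g x \<and>
      (g has_derivative (\<lambda>h. \<Sum>j\<in>UNIV. h $ j * (\<Sum>k. d k j x))) (at x within ball a t)"
  proof (rule has_derivative_series[where f' = "\<lambda>k x h. \<Sum>j\<in>UNIV. h $ j * d k j x"])
    show "((\<lambda>x. c k * mono_at a (e k) x) has_derivative (\<lambda>h. \<Sum>j\<in>UNIV. h $ j * d k j x))
        (at x within ball a t)" for k x
    proof -
      have "((\<lambda>x. r * mono_at a (e k) x) has_derivative (\<lambda>h. r * (\<Sum>j\<in>UNIV.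
           h $ j * (real (e k j) * mono_at a (lower j (e k)) x)))) (at x within ball a t)" for r
        by (intro has_derivative_mult_right has_derivative_at_withinI[OF has_derivative_mono_at])
      from this[of "c k"] show ?thesis
        by (simp add: d_def sum_distrib_left mult_ac)
    qed
    show "\<forall>\<^sub>F n in sequentially. \<forall>x\<in>ball a t. \<forall>h.
        norm ((\<Sum>i<n. \<Sum>j\<in>UNIV. h $ j * d i j x) - (\<Sum>j\<in>UNIV. h $ j * (\<Sum>k. d k j x)))
          \<le> \<epsilon> * norm h" if "\<epsilon> > 0" for \<epsilon>
    proof -
      have pos: "\<epsilon> / real CARD('m) > 0" using that by simp
      have "\<forall>\<^sub>F n in sequentially. \<forall>j. \<forall>x\<in>ball a t.
          dist (\<Sum>k<n. d k j x) (\<Sum>k. d k j x) < \<epsilon> / real CARD('m)"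
        by (rule eventually_all_finite) (use uniform_limitD[OF unif pos] in blast)
      then show ?thesis
      proof (rule eventually_mono, intro ballI allI)
        fix n x and h :: "real ^ 'm"
        assume close: "\<forall>j. \<forall>x\<in>ball a t.
            dist (\<Sum>k<n. d k j x) (\<Sum>k. d k j x) < \<epsilon> / real CARD('m)" and x: "x \<in> ball a t"
        have "(\<Sum>i<n. \<Sum>j\<in>UNIV. h $ j * d i j x) - (\<Sum>j\<in>UNIV. h $ j * (\<Sum>k. d k j x))
            = (\<Sum>j\<in>UNIV. h $ j * ((\<Sum>k<n. d k j x) - (\<Sum>k. d k j x)))"
          by (subst sum.swap) (simp add: sum_distrib_left right_diff_distrib sum_subtractf)
        also have "norm \<dots> \<le> (\<Sum>j\<in>(UNIV::'m set). norm h * (\<epsilon> / real CARD('m)))"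
        proof (rule sum_norm_le)
          fix j
          have "\<bar>h $ j\<bar> \<le> norm h" by (rule component_le_norm_cart)
          moreover have "\<bar>(\<Sum>k<n. d k j x) - (\<Sum>k. d k j x)\<bar> \<le> \<epsilon> / real CARD('m)"
            using close x by (auto simp: dist_real_def intro: less_imp_le)
          ultimately show "norm (h $ j * ((\<Sum>k<n. d k j x) - (\<Sum>k. d k j x)))
              \<le> norm h * (\<epsilon> / real CARD('m))"
            by (simp only: real_norm_def abs_mult) (intro mult_mono, auto)
        qed
        finally show "norm ((\<Sum>i<n. \<Sum>j\<in>UNIV. h $ j * d i j x)
            - (\<Sum>j\<in>UNIV. h $ j * (\<Sum>k. d k j x))) \<le> \<epsilon> * norm h"
          by (simp add: mult.commute)
      qed
    qed
    show "(\<lambda>k. c k * mono_at a (e k) y) sums (\<Sum>k. c k * mono_at a (e k) y)"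
      by (rule summable_sums[OF summ[OF y]])
  qed (use y in auto)
  then obtain g where g: "\<And>x. x \<in> ball a t \<Longrightarrow> (\<lambda>k. c k * mono_at a (e k) x) sums g x"
    and g': "(g has_derivative (\<lambda>h. \<Sum>j\<in>UNIV. h $ j * (\<Sum>k. d k j y))) (at y within ball a t)"
    using y by blast
  have "((\<lambda>y. \<Sum>k. c k * mono_at a (e k) y) has_derivative
      (\<lambda>h. \<Sum>j\<in>UNIV. h $ j * (\<Sum>k. d k j y))) (at y within ball a t)"
    by (rule has_derivative_transform[OF y _ g']) (simp add: sums_unique[OF g])
  then show ?thesis
    using at_within_open[OF y open_ball] by (simp add: d_def)
qed

lemma partial_deriv_of_has_derivative:
  assumes "(g has_derivative (\<lambda>h. \<Sum>j\<in>UNIV. h $ j * G j)) (at y)"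
  shows "partial_deriv j g y = G j"
proof -
  have "((\<lambda>t. y + t *\<^sub>R axis j 1) has_derivative (\<lambda>t. t *\<^sub>R axis j 1)) (at 0)"
    by (auto intro!: derivative_eq_intros)
  moreover have "(g has_derivative (\<lambda>h. \<Sum>j\<in>UNIV. h $ j * G j)) (at (y + 0 *\<^sub>R axis j 1))"
    using assms by simp
  ultimately have "((\<lambda>t. g (y + t *\<^sub>R axis j 1)) has_derivative
      (\<lambda>t. \<Sum>i\<in>UNIV. (t *\<^sub>R axis j 1) $ i * G i)) (at 0)"
    by (rule has_derivative_compose)
  also have "(\<lambda>t. \<Sum>i\<in>UNIV. (t *\<^sub>R axis j 1) $ i * G i) = (\<lambda>t. t * G j)"
    by (auto simp: axis_def if_distrib[of "\<lambda>x. _ * x"] if_distrib[of "\<lambda>x. x * _"] cong: if_cong)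
  finally have "((\<lambda>t. g (y + t *\<^sub>R axis j 1)) has_field_derivative G j) (at 0)"
    by (simp add: has_field_derivative_def mult_commute_abs)
  then show ?thesis
    unfolding partial_deriv_def by (rule DERIV_imp_deriv)
qed

text \<open>
  Unordered convergence at the corner \<open>a + (s, \<dots>, s)\<close> of a small cube is absolute, and there the
  monomial of exponent \<open>\<kappa>\<close> equals \<open>s\<close> to the power of its degree. This gives the numerical bound,
  once the multi-indices are enumerated by the natural numbers.
\<close>

lemma real_analytic_imp_monomial_series:
  fixes g :: "real ^ 'm::finite \<Rightarrow> real"
  assumes "real_analytic_on g S" "a \<in> S"
  obtains s and c :: "nat \<Rightarrow> real" and e :: "nat \<Rightarrow> 'm \<Rightarrow> nat" where "0 < s" "ball a s \<subseteq> S"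
    "summable (\<lambda>k. \<bar>c k\<bar> * s ^ (\<Sum>i\<in>UNIV. e k i))"
    "\<And>y. y \<in> ball a s \<Longrightarrow> g y = (\<Sum>k. c k * mono_at a (e k) y)"
proof -
  obtain r C where r: "r > 0" "ball a r \<subseteq> S"
    and C: "\<And>y. y \<in> ball a r \<Longrightarrow> ((\<lambda>\<kappa>. C \<kappa> * mono_at a \<kappa> y) has_sum g y) UNIV"
    using assms unfolding real_analytic_on_def mono_at_def by meson
  define e :: "nat \<Rightarrow> 'm \<Rightarrow> nat" where "e = from_nat_into UNIV"
  have "infinite (UNIV :: ('m \<Rightarrow> nat) set)"
  proof
    assume "finite (UNIV :: ('m \<Rightarrow> nat) set)"
    then have "finite (range (\<lambda>n::nat. (\<lambda>_::'m. n)))" by (rule rev_finite_subset) simp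
    moreover have "inj (\<lambda>n::nat. (\<lambda>_::'m. n))" by (auto simp: inj_def fun_eq_iff)
    ultimately show False using finite_imageD by blast
  qed
  then have bij: "bij_betw e UNIV UNIV"
    unfolding e_def by (intro bij_betw_from_nat_into) auto
  have hs: "((\<lambda>k. C (e k) * mono_at a (e k) y) has_sum g y) UNIV" if "y \<in> ball a r" for y
    using C[OF that] has_sum_reindex_bij_betw[OF bij, of "\<lambda>\<kappa>. C \<kappa> * mono_at a \<kappa> y"] by simp
  \<comment> \<open>The corner must lie in the ball of radius \<open>r\<close>; its distance from \<open>a\<close> is at most \<open>CARD('m) * s\<close>.\<close>
  define s where "s = r / (2 * real CARD('m))"
  have s: "0 < s" using r by (simp add: s_def)
  have "s \<le> r / 2" unfolding s_def using r
    by (intro divide_left_mono) (auto simp: Suc_le_eq)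
  then have sr: "ball a s \<subseteq> ball a r" using r by auto
  define b where "b = a + (\<chi> i. s)"
  have "norm (\<chi> i::'m. s) \<le> (\<Sum>i\<in>(UNIV::'m set). \<bar>s\<bar>)"
    using norm_le_l1_cart[of "\<chi> i::'m. s"] by simp
  then have "norm (\<chi> i::'m. s) \<le> r / 2" using r by (simp add: s_def)
  then have b: "b \<in> ball a r" using r by (simp add: b_def dist_norm)
  have "(\<lambda>k. C (e k) * mono_at a (e k) b) summable_on UNIV"
    using hs[OF b] by (auto simp: summable_on_def)
  then have "(\<lambda>k. norm (C (e k) * mono_at a (e k) b)) summable_on UNIV"
    by (rule summable_on_iff_abs_summable_on_real[THEN iffD1])
  then have "summable (\<lambda>k. norm (C (e k) * mono_at a (e k) b))"
    by (rule summable_on_imp_summable)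
  moreover have "mono_at a \<kappa> b = s ^ (\<Sum>i\<in>UNIV. \<kappa> i)" for \<kappa>
    by (simp add: mono_at_def b_def power_sum)
  ultimately have summ: "summable (\<lambda>k. \<bar>C (e k)\<bar> * s ^ (\<Sum>i\<in>UNIV. e k i))"
    using s by (simp add: abs_mult)
  have "g y = (\<Sum>k. C (e k) * mono_at a (e k) y)" if "y \<in> ball a s" for y
    by (rule sums_unique, rule has_sum_imp_sums, rule hs) (use sr that in auto)
  with s sr r summ show thesis by (intro that[of s "\<lambda>k. C (e k)" e]) auto
qed

text \<open>
  Two differentiations, on the radii \<open>s / 2\<close> and \<open>s / 3\<close>. The Hessian is symmetric because
  lowering two exponents in either order gives the same exponent and the same integer factor.
\<close>

lemma real_analytic_has_derivative:
  fixes g :: "real ^ 'm::finite \<Rightarrow> real"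
  assumes "real_analytic_on g S" "a \<in> S"
  shows "(g has_derivative (\<lambda>h. \<Sum>j\<in>UNIV. h $ j * partial_deriv j g a)) (at a)"
    and "\<exists>H. (\<forall>i j. H i j = H j i) \<and>
      (\<forall>j. (partial_deriv j g has_derivative (\<lambda>h. \<Sum>i\<in>UNIV. h $ i * H j i)) (at a))"
proof -
  obtain s c and e :: "nat \<Rightarrow> 'm \<Rightarrow> nat" where s: "0 < s" "ball a s \<subseteq> S"
    and summ: "summable (\<lambda>k. \<bar>c k\<bar> * s ^ (\<Sum>i\<in>UNIV. e k i))"
    and g: "\<And>y. y \<in> ball a s \<Longrightarrow> g y = (\<Sum>k. c k * mono_at a (e k) y)"
    by (rule real_analytic_imp_monomial_series[OF assms]) blast
  define G where "G j y = (\<Sum>k. (c k * real (e k j)) * mono_at a (lower j (e k)) y)" for j y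
  have t: "0 < s / 2" "s / 2 < s" "0 < s / 3" "s / 3 < s / 2" using s by auto
  have g': "(g has_derivative (\<lambda>h. \<Sum>j\<in>UNIV. h $ j * G j y)) (at y)" if "y \<in> ball a (s / 2)" for y
  proof (rule has_derivative_transform_within_open[OF _ open_ball that])
    show "((\<lambda>y. \<Sum>k. c k * mono_at a (e k) y) has_derivative (\<lambda>h. \<Sum>j\<in>UNIV. h $ j * G j y)) (at y)"
      unfolding G_def by (rule monomial_series_has_derivative[OF summ t(1,2) that])
    show "(\<Sum>k. c k * mono_at a (e k) x) = g x" if "x \<in> ball a (s / 2)" for x
      using g[of x] that s by simp
  qed
  have pd: "partial_deriv j g y = G j y" if "y \<in> ball a (s / 2)" for j y
    by (rule partial_deriv_of_has_derivative[OF g'[OF that]])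
  have a: "a \<in> ball a (s / 2)" "a \<in> ball a (s / 3)" using t by auto
  from g'[OF a(1)] show "(g has_derivative (\<lambda>h. \<Sum>j\<in>UNIV. h $ j * partial_deriv j g a)) (at a)"
    by (simp add: pd[OF a(1)])
  define H where "H j i = (\<Sum>k. (c k * real (e k j) * real (lower j (e k) i))
      * mono_at a (lower i (lower j (e k))) a)" for j i
  have "H i j = H j i" for i j
  proof -
    have "real (e k i) * real (lower i (e k) j) = real (e k j) * real (lower j (e k) i)"
      "lower i (lower j (e k)) = lower j (lower i (e k))" for k
      by (auto simp: lower_def fun_upd_twist)
    then show ?thesis by (simp add: H_def mult.assoc)
  qed
  moreover have "(partial_deriv j g has_derivative (\<lambda>h. \<Sum>i\<in>UNIV. h $ i * H j i)) (at a)" for j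
  proof (rule has_derivative_transform_within_open[OF _ open_ball a(1)])
    show "(G j has_derivative (\<lambda>h. \<Sum>i\<in>UNIV. h $ i * H j i)) (at a)"
      unfolding G_def[abs_def] H_def
      by (rule monomial_series_has_derivative[OF summable_lower[OF summ t(1,2)] t(3,4) a(2)])
  qed (simp add: pd)
  ultimately show "\<exists>H. (\<forall>i j. H i j = H j i) \<and>
      (\<forall>j. (partial_deriv j g has_derivative (\<lambda>h. \<Sum>i\<in>UNIV. h $ i * H j i)) (at a))"
    by blast
qed

section \<open>The common kernel of the differential of rho and its image under A\<close>

lemma sum_UNIV_two_plus:
  fixes h :: "2 + 'q::finite \<Rightarrow> 'b::comm_monoid_add"
  shows "(\<Sum>k\<in>UNIV. h k) = h i1 + h i2 + (\<Sum>i\<in>UNIV. h (Inr i))"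
proof -
  have "(\<Sum>k\<in>UNIV. h k) = (\<Sum>k\<in>UNIV <+> UNIV. h k)" by simp
  also have "\<dots> = (\<Sum>a\<in>UNIV. h (Inl a)) + (\<Sum>i\<in>UNIV. h (Inr i))"
    by (subst sum.Plus) auto
  finally show ?thesis by (simp add: sum_2)
qed

text \<open>
  The values of \<open>\<partial>f / \<partial>x\<^sub>1\<close> that are tangent to the level sets of \<open>\<rho>\<close> and whose image
  \<open>\<partial>f / \<partial>x\<^sub>2\<close> under \<open>A\<close> is tangent as well form a space with this basis; the \<open>p\<^sup>j\<^sub>1\<close> are the
  coordinates with respect to it.
\<close>

definition frame ::
    "(real ^ (2 + 'q::finite) \<Rightarrow> real) \<Rightarrow> (real ^ (2 + 'q) \<Rightarrow> real ^ (2 + 'q) ^ (2 + 'q))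
      \<Rightarrow> 'q \<Rightarrow> real ^ (2 + 'q) \<Rightarrow> real ^ (2 + 'q)" where
  "frame \<rho> A j y = (\<chi> k. case k of
      Inl a \<Rightarrow> if a = 1 then gamma1 \<rho> A j y else gamma2 \<rho> A j y
    | Inr i \<Rightarrow> if i = j then 1 else 0)"

lemma frame_simps [simp]:
  "frame \<rho> A j y $ i1 = gamma1 \<rho> A j y"
  "frame \<rho> A j y $ i2 = gamma2 \<rho> A j y"
  "frame \<rho> A j y $ Inr i = (if i = j then 1 else 0)"
  by (simp_all add: frame_def)

lemma sum_times_frame:
  "(\<Sum>k\<in>UNIV. h k * frame \<rho> A j y $ k)
    = h i1 * gamma1 \<rho> A j y + h i2 * gamma2 \<rho> A j y + h (Inr j)"
  by (simp add: sum_UNIV_two_plus if_distrib[of "\<lambda>x. _ * x"] cong: if_cong)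

lemma beta_eq_A_frame: "beta \<rho> A k j y = (A y *v frame \<rho> A j y) $ k"
  by (simp add: matrix_vector_mult_def sum_times_frame beta_def)

text \<open>
  The definitions of \<open>\<gamma>\<^sup>1\<close>, \<open>\<gamma>\<^sup>2\<close> are Cramer's rule for the two equations
  \<open>\<rho>\<^sub>1 \<gamma>\<^sup>1\<^sub>j + \<rho>\<^sub>2 \<gamma>\<^sup>2\<^sub>j = - \<rho>\<^sub>j\<close> and \<open>\<mu>\<^sub>1 \<gamma>\<^sup>1\<^sub>j + \<mu>\<^sub>2 \<gamma>\<^sup>2\<^sub>j = - \<mu>\<^sub>j\<close>, whose determinant is \<open>D\<close>. This
  lemma and \<open>mu_frame\<close> say that they are solved.
\<close>

lemma rho_frame:
  assumes "D \<rho> A y \<noteq> 0"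
  shows "(\<Sum>k\<in>UNIV. rho_d \<rho> k y * frame \<rho> A j y $ k) = 0"
proof -
  have "D \<rho> A y * (\<Sum>k\<in>UNIV. rho_d \<rho> k y * frame \<rho> A j y $ k) = 0"
    using assms by (simp add: sum_times_frame gamma1_def gamma2_def field_simps)
      (simp add: D_def algebra_simps)
  with assms show ?thesis by simp
qed

lemma mu_frame:
  assumes "D \<rho> A y \<noteq> 0"
  shows "(\<Sum>k\<in>UNIV. mu \<rho> A k y * frame \<rho> A j y $ k) = 0"
proof -
  have "D \<rho> A y * (\<Sum>k\<in>UNIV. mu \<rho> A k y * frame \<rho> A j y $ k) = 0"
    using assms by (simp add: sum_times_frame gamma1_def gamma2_def field_simps)
      (simp add: D_def algebra_simps)
  with assms show ?thesis by simp
qed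

text \<open>
  A covector that kills the frame has its last components determined by its first two, so pairing
  with it only sees the part of \<open>w\<close> that is left after the last components have been removed by
  means of the frame. It is used with \<open>w\<close> the torsion and with \<open>w\<close> a column of \<open>\<beta>\<close>.
\<close>

lemma pairing_of_annihilator:
  assumes "\<And>i. (\<Sum>k\<in>UNIV. r k * frame \<rho> A i y $ k) = 0"
  shows "(\<Sum>k\<in>UNIV. r k * w k)
    = r i1 * (w i1 - (\<Sum>i\<in>UNIV. gamma1 \<rho> A i y * w (Inr i)))
      + r i2 * (w i2 - (\<Sum>i\<in>UNIV. gamma2 \<rho> A i y * w (Inr i)))"
proof -
  have "r (Inr i) = - (r i1 * gamma1 \<rho> A i y) - r i2 * gamma2 \<rho> A i y" for i
    using assms[of i] by (simp add: sum_times_frame)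
  then show ?thesis
    by (simp add: sum_UNIV_two_plus right_diff_distrib left_diff_distrib sum_distrib_left
        sum_negf sum_subtractf mult.assoc)
qed

lemma sum_times_matrix_vector:
  fixes r :: "'k::finite \<Rightarrow> real" and B :: "real ^ 'm ^ 'k"
  shows "(\<Sum>k\<in>UNIV. r k * (B *v v) $ k) = (\<Sum>l\<in>UNIV. (\<Sum>k\<in>UNIV. r k * B $ k $ l) * v $ l)"
  unfolding matrix_vector_mult_def
  by (simp add: sum_distrib_left sum_distrib_right mult.assoc) (rule sum.swap)

lemma rho_A: "(\<Sum>k\<in>UNIV. rho_d \<rho> k y * (A y *v v) $ k) = (\<Sum>l\<in>UNIV. mu \<rho> A l y * v $ l)"
  by (simp add: sum_times_matrix_vector mu_def)

lemma mu_A: "(\<Sum>k\<in>UNIV. mu \<rho> A k y * (A y *v v) $ k) = (\<Sum>l\<in>UNIV. mu2 \<rho> A l y * v $ l)"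
proof -
  have "(\<Sum>l\<in>UNIV. mu2 \<rho> A l y * v $ l) = (\<Sum>k\<in>UNIV. rho_d \<rho> k y * ((A y ** A y) *v v) $ k)"
    by (simp add: sum_times_matrix_vector mu2_def)
  also have "\<dots> = (\<Sum>k\<in>UNIV. mu \<rho> A k y * (A y *v v) $ k)"
    by (simp add: matrix_vector_mul_assoc[symmetric] rho_A)
  finally show ?thesis by simp
qed

text \<open>
  This is the meaning of \<open>D0\<close>: it measures whether a vector killed by \<open>\<nabla>\<rho>\<close> and \<open>\<nabla>\<rho> A\<close> is also
  killed by \<open>\<nabla>\<rho> A\<^sup>2\<close>. The factor of \<open>- (1 / D\<^sup>2)\<close> in its definition is the expansion of minus the
  \<open>3 \<times> 3\<close> determinant with rows \<open>\<rho>\<close>, \<open>\<mu>\<close>, \<open>\<mu>\<^sup>(\<^sup>2\<^sup>)\<close> in the columns \<open>1\<close>, \<open>2\<close>, \<open>j\<close>.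
\<close>

lemma mu2_frame:
  assumes "D \<rho> A y \<noteq> 0"
  shows "(\<Sum>k\<in>UNIV. mu2 \<rho> A k y * frame \<rho> A j y $ k) = D \<rho> A y * D0 \<rho> A y $ j"
proof -
  have "(D \<rho> A y)\<^sup>2 * (\<Sum>k\<in>UNIV. mu2 \<rho> A k y * frame \<rho> A j y $ k)
      = (D \<rho> A y)\<^sup>2 * (D \<rho> A y * D0 \<rho> A y $ j)"
    using assms
    by (simp add: sum_times_frame gamma1_def gamma2_def D0_def field_simps power2_eq_square)
      (simp add: D_def algebra_simps)
  with assms show ?thesis by simp
qed

text \<open>
  The coefficients of the absorption system after elimination of \<open>v\<^sub>2\<close>. Both covectors \<open>\<nabla>\<rho>\<close> and \<open>\<mu>\<close>
  kill the frame, so \<open>pairing_of_annihilator\<close> turns their values on \<open>A w\<^sub>j\<close>, namely \<open>0\<close> and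
  \<open>D D0\<^sub>j\<close>, into two linear equations for the two left-hand sides, again with determinant \<open>D\<close>.
\<close>

lemma beta_reduced:
  assumes "D \<rho> A y \<noteq> 0"
  shows "(\<Sum>i\<in>UNIV. gamma1 \<rho> A i y * beta \<rho> A (Inr i) j y) - beta \<rho> A i1 j y
      = rho_d \<rho> i2 y * D0 \<rho> A y $ j" (is "?a = _")
    and "(\<Sum>i\<in>UNIV. gamma2 \<rho> A i y * beta \<rho> A (Inr i) j y) - beta \<rho> A i2 j y
      = - rho_d \<rho> i1 y * D0 \<rho> A y $ j" (is "?b = _")
proof -
  have comb: "r i1 * ?a + r i2 * ?b = - (\<Sum>k\<in>UNIV. r k * beta \<rho> A k j y)"
    if "\<And>i. (\<Sum>k\<in>UNIV. r k * frame \<rho> A i y $ k) = 0" for r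
    using pairing_of_annihilator[OF that, of "\<lambda>k. beta \<rho> A k j y"]
    by (simp add: right_diff_distrib)
  have rho: "rho_d \<rho> i1 y * ?a + rho_d \<rho> i2 y * ?b = 0"
    using comb[OF rho_frame[OF assms]] by (simp add: beta_eq_A_frame rho_A mu_frame[OF assms])
  have mu: "mu \<rho> A i1 y * ?a + mu \<rho> A i2 y * ?b = - (D \<rho> A y * D0 \<rho> A y $ j)"
    using comb[OF mu_frame[OF assms]] by (simp add: beta_eq_A_frame mu_A mu2_frame[OF assms])
  have cramer: "d * a = d * (r2 * t)" "d * b = d * (- r1 * t)"
    if "r1 * a + r2 * b = 0" "m1 * a + m2 * b = - (d * t)" "d = r1 * m2 - r2 * m1"
    for a b r1 r2 m1 m2 d t :: real
    using that by algebra+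
  show "?a = rho_d \<rho> i2 y * D0 \<rho> A y $ j" "?b = - rho_d \<rho> i1 y * D0 \<rho> A y $ j"
    using cramer[OF rho mu D_def] unfolding mult_left_cancel[OF assms] by this
qed

section \<open>The torsion as a bracket\<close>

lemma theta_eq:
  "theta \<rho> A k z u = df k u
    - (\<Sum>j\<in>UNIV. dp j z * frame \<rho> A j (fst (snd z)) $ k) * dx 1 u
    - (\<Sum>j\<in>UNIV. dp j z * (A (fst (snd z)) *v frame \<rho> A j (fst (snd z))) $ k) * dx 2 u"
proof (cases z)
  case (fields x f p)
  show ?thesis
  proof (cases k)
    case (Inl a)
    then show ?thesis using exhaust_2[of a] fields
      by (auto simp: theta_def theta1_def theta2_def dp_def beta_eq_A_frame mult_ac)
  next
    case (Inr i)
    then show ?thesis using fields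
      by (simp add: theta_def theta_rest_def dp_def beta_eq_A_frame mult_ac
          if_distrib[of "\<lambda>x. _ * x"] if_distrib[of "\<lambda>x. x * _"] cong: if_cong)
  qed
qed

text \<open>
  In the coframe \<open>dx\<close>, \<open>\<theta>\<close>, \<open>dp\<close> the vectors dual to \<open>dx\<^sub>1\<close>, \<open>dx\<^sub>2\<close> are
  \<open>E\<^sub>1 = \<partial>\<^sub>x\<^sub>1 + P\<close> and \<open>E\<^sub>2 = \<partial>\<^sub>x\<^sub>2 + Q\<close>. Evaluation at \<open>(E\<^sub>1, E\<^sub>2)\<close> kills the ideal and all terms
  that contain a \<open>dp\<^sub>j\<close>, so it singles out \<open>c\<^sup>k\<close>: the coefficient is unique. That it exists follows by
  expanding \<open>d\<theta>\<^sup>k = - dP\<^sub>k \<and> dx\<^sub>1 - dQ\<^sub>k \<and> dx\<^sub>2\<close> with \<open>df\<^sub>l = \<theta>\<^sup>l + P\<^sub>l dx\<^sub>1 + Q\<^sub>l dx\<^sub>2\<close>.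
\<close>

lemma torsion_eq_bracket:
  fixes W V :: "'q::finite \<Rightarrow> real ^ (2 + 'q) \<Rightarrow> real ^ (2 + 'q)"
  assumes theta: "\<And>k z u. theta \<rho> A k z u = df k u
      - (\<Sum>j\<in>UNIV. dp j z * W j (fst (snd z)) $ k) * dx 1 u
      - (\<Sum>j\<in>UNIV. dp j z * V j (fst (snd z)) $ k) * dx 2 u"
    and W: "\<And>j. (W j has_derivative W' j) (at f)"
    and V: "\<And>j. (V j has_derivative V' j) (at f)"
  shows "torsion \<rho> A k (x, f, p) =
    (\<Sum>j\<in>UNIV. p $ j * W' j (\<Sum>i\<in>UNIV. p $ i *\<^sub>R V i f) $ k)
    - (\<Sum>j\<in>UNIV. p $ j * V' j (\<Sum>i\<in>UNIV. p $ i *\<^sub>R W i f) $ k)"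
proof -
  define z where "z = (x, f, p)"
  define P where "P = (\<Sum>i\<in>UNIV. p $ i *\<^sub>R W i f)"
  define Q where "Q = (\<Sum>i\<in>UNIV. p $ i *\<^sub>R V i f)"
  define \<phi> where "\<phi> h = (\<Sum>j\<in>UNIV. p $ j * W' j h $ k)" for h
  define \<psi> where "\<psi> h = (\<Sum>j\<in>UNIV. p $ j * V' j h $ k)" for h
  define F where "F u = \<phi> (fst (snd u)) + (\<Sum>j\<in>UNIV. W j f $ k * dp j u)" for u
  define G where "G u = \<psi> (fst (snd u)) + (\<Sum>j\<in>UNIV. V j f $ k * dp j u)" for u
  note linW = has_derivative_linear[OF W] and linV = has_derivative_linear[OF V]
  have lin: "linear \<phi>" "linear \<psi>"
    unfolding \<phi>_def \<psi>_def using linW linV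
    by (auto intro!: linearI simp: linear_add linear_scale sum.distrib algebra_simps sum_distrib_left)
  have coeff: "((\<lambda>w. \<Sum>j\<in>UNIV. dp j w * X j (fst (snd w)) $ k) has_derivative
        (\<lambda>u. (\<Sum>j\<in>UNIV. p $ j * X' j (fst (snd u)) $ k) + (\<Sum>j\<in>UNIV. X j f $ k * dp j u))) (at z)"
    if X: "\<And>j. (X j has_derivative X' j) (at f)"
    for X X' :: "'q \<Rightarrow> real ^ (2 + 'q) \<Rightarrow> real ^ (2 + 'q)"
  proof -
    have f: "((\<lambda>w. fst (snd w)) has_derivative (\<lambda>u. fst (snd u))) (at z)"
      by (intro has_derivative_fst has_derivative_snd has_derivative_ident)
    have "((\<lambda>w. X j (fst (snd w))) has_derivative (\<lambda>u. X' j (fst (snd u)))) (at z)" for j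
      by (rule has_derivative_compose[OF f]) (simp add: z_def X)
    then have Xk: "((\<lambda>w. X j (fst (snd w)) $ k) has_derivative (\<lambda>u. X' j (fst (snd u)) $ k)) (at z)" for j
      by (rule bounded_linear.has_derivative[OF bounded_linear_vec_nth])
    have dp: "(dp j has_derivative dp j) (at z)" for j
      unfolding dp_def[abs_def]
      by (intro bounded_linear.has_derivative[OF bounded_linear_vec_nth] has_derivative_snd has_derivative_ident)
    have "((\<lambda>w. \<Sum>j\<in>UNIV. dp j w * X j (fst (snd w)) $ k) has_derivative
        (\<lambda>u. \<Sum>j\<in>UNIV. dp j z * X' j (fst (snd u)) $ k + dp j u * X j (fst (snd z)) $ k)) (at z)"
      by (intro has_derivative_sum has_derivative_mult dp Xk)
    then show ?thesis
      by (simp add: sum.distrib mult.commute) (simp add: z_def dp_def)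
  qed
  have "((\<lambda>w. theta \<rho> A k w v) has_derivative (\<lambda>u. 0 - F u * dx 1 v - G u * dx 2 v)) (at z)" for v
    unfolding theta F_def G_def \<phi>_def \<psi>_def
    by (intro has_derivative_diff has_derivative_const has_derivative_mult_left coeff W V)
  from frechet_derivative_at[OF this, symmetric]
  have ext: "ext_deriv (theta \<rho> A k) z u v = - wedge F (dx 1) u v - wedge G (dx 2) u v" for u v
    by (simp add: ext_deriv_def wedge_def)
  have theta_z: "theta \<rho> A l z u = df l u - P $ l * dx 1 u - Q $ l * dx 2 u" for l u
    by (simp add: theta P_def Q_def z_def dp_def)
  \<comment> \<open>The terms of \<open>d\<theta>\<^sup>k\<close> with a factor \<open>\<theta>\<^sup>l\<close>: \<open>\<phi>\<close> and \<open>\<psi>\<close> are the \<open>f\<close>-parts of \<open>dP\<^sub>k\<close> and \<open>dQ\<^sub>k\<close>.\<close>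
  define \<eta> where "\<eta> l u = \<phi> (axis l 1) * dx 1 u + \<psi> (axis l 1) * dx 2 u" for l and u :: "'q jet"
  have lin_\<eta>: "linear (\<eta> l)" for l
    by (rule linearI) (simp_all add: \<eta>_def dx_def algebra_simps)
  \<comment> \<open>Replacing \<open>df\<^sub>l\<close> by \<open>\<theta>\<^sup>l\<close> in a linear form in the \<open>df\<^sub>l\<close> costs its values on \<open>P\<close> and \<open>Q\<close>.\<close>
  have expand: "(\<Sum>l\<in>UNIV. L (axis l 1) * theta \<rho> A l z u)
      = L (fst (snd u)) - L P * dx 1 u - L Q * dx 2 u" if "linear L" for L u
  proof -
    have L: "(\<Sum>l\<in>UNIV. L (axis l 1) * h $ l) = L h" for h
    proof -
      have "L h = L (\<Sum>l\<in>UNIV. h $ l *\<^sub>R axis l 1)"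
        using basis_expansion[of h] by (simp add: scalar_mult_eq_scaleR)
      then show ?thesis using that by (simp add: linear_sum linear_scale mult.commute)
    qed
    have "(\<Sum>l\<in>UNIV. L (axis l 1) * theta \<rho> A l z u)
        = (\<Sum>l\<in>UNIV. L (axis l 1) * (fst (snd u) - dx 1 u *\<^sub>R P - dx 2 u *\<^sub>R Q) $ l)"
      by (simp add: theta_z df_def mult.commute)
    also have "\<dots> = L (fst (snd u) - dx 1 u *\<^sub>R P - dx 2 u *\<^sub>R Q)" by (rule L)
    finally show ?thesis using that by (simp add: linear_diff linear_scale mult.commute)
  qed
  have \<eta>\<theta>: "(\<Sum>l\<in>UNIV. \<eta> l u * theta \<rho> A l z v)
      = dx 1 u * (\<phi> (fst (snd v)) - \<phi> P * dx 1 v - \<phi> Q * dx 2 v)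
      + dx 2 u * (\<psi> (fst (snd v)) - \<psi> P * dx 1 v - \<psi> Q * dx 2 v)" for u v
    unfolding expand[OF lin(1), symmetric] expand[OF lin(2), symmetric]
    by (simp add: \<eta>_def sum_distrib_left sum.distrib algebra_simps)
  have rep: "cong_mod_ideal (\<lambda>l. theta \<rho> A l z) (ext_deriv (theta \<rho> A k) z)
     (\<lambda>u v. (\<Sum>j\<in>UNIV. - W j f $ k * wedge (dp j) (dx 1) u v)
          + (\<Sum>j\<in>UNIV. - V j f $ k * wedge (dp j) (dx 2) u v)
          + (\<phi> Q - \<psi> P) * wedge (dx 1) (dx 2) u v)"
    unfolding cong_mod_ideal_def
  proof (intro exI conjI allI, rule lin_\<eta>)
    fix u v :: "'q jet"
    have dp_wedge: "(\<Sum>j\<in>UNIV. - X j * wedge (dp j) (dx a) u v)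
        = - ((\<Sum>j\<in>UNIV. X j * dp j u) * dx a v - (\<Sum>j\<in>UNIV. X j * dp j v) * dx a u)" for X a
      by (simp add: wedge_def sum_distrib_left sum_distrib_right sum_negf sum_subtractf algebra_simps)
    have "(\<Sum>l\<in>UNIV. wedge (\<eta> l) (theta \<rho> A l z) u v)
      = (\<Sum>l\<in>UNIV. \<eta> l u * theta \<rho> A l z v) - (\<Sum>l\<in>UNIV. \<eta> l v * theta \<rho> A l z u)"
      by (simp add: wedge_def sum_subtractf)
    then show "ext_deriv (theta \<rho> A k) z u v
        - ((\<Sum>j\<in>UNIV. - W j f $ k * wedge (dp j) (dx 1) u v)
          + (\<Sum>j\<in>UNIV. - V j f $ k * wedge (dp j) (dx 2) u v)
          + (\<phi> Q - \<psi> P) * wedge (dx 1) (dx 2) u v)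
        = (\<Sum>l\<in>UNIV. wedge (\<eta> l) (theta \<rho> A l z) u v)"
      unfolding ext dp_wedge \<eta>\<theta> by (simp add: wedge_def F_def G_def algebra_simps)
  qed
  define E1 where "E1 = (axis 1 1 :: real ^ 2, P, 0 :: real ^ 'q)"
  define E2 where "E2 = (axis 2 1 :: real ^ 2, Q, 0 :: real ^ 'q)"
  have dual: "dx 1 E1 = 1" "dx 2 E1 = 0" "dx 1 E2 = 0" "dx 2 E2 = 1"
    "dp j E1 = 0" "dp j E2 = 0" "theta \<rho> A l z E1 = 0" "theta \<rho> A l z E2 = 0" for j l
    by (simp_all add: theta_z E1_def E2_def dx_def df_def dp_def axis_def)
  have coeff_eq: "c = ext_deriv (theta \<rho> A k) z E1 E2"
    if congruent: "cong_mod_ideal (\<lambda>l. theta \<rho> A l z) (ext_deriv (theta \<rho> A k) z)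
       (\<lambda>u v. (\<Sum>j\<in>UNIV. a j * wedge (dp j) (dx 1) u v)
            + (\<Sum>j\<in>UNIV. b j * wedge (dp j) (dx 2) u v)
            + c * wedge (dx 1) (dx 2) u v)" for a b c
  proof -
    obtain \<eta>' where "\<forall>u v. ext_deriv (theta \<rho> A k) z u v
        - ((\<Sum>j\<in>UNIV. a j * wedge (dp j) (dx 1) u v)
            + (\<Sum>j\<in>UNIV. b j * wedge (dp j) (dx 2) u v)
            + c * wedge (dx 1) (dx 2) u v) = (\<Sum>l\<in>UNIV. wedge (\<eta>' l) (theta \<rho> A l z) u v)"
      using congruent unfolding cong_mod_ideal_def by blast
    from this[rule_format, of E1 E2] show ?thesis by (simp add: wedge_def dual)
  qed
  have "torsion \<rho> A k z = \<phi> Q - \<psi> P"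
    unfolding torsion_def
  proof (rule the_equality)
    show "\<exists>a b. cong_mod_ideal (\<lambda>l. theta \<rho> A l z) (ext_deriv (theta \<rho> A k) z)
       (\<lambda>u v. (\<Sum>j\<in>UNIV. a j * wedge (dp j) (dx 1) u v)
            + (\<Sum>j\<in>UNIV. b j * wedge (dp j) (dx 2) u v)
            + (\<phi> Q - \<psi> P) * wedge (dx 1) (dx 2) u v)"
      by (intro exI, rule rep)
    show "c = \<phi> Q - \<psi> P" if "\<exists>a b. cong_mod_ideal (\<lambda>l. theta \<rho> A l z) (ext_deriv (theta \<rho> A k) z)
       (\<lambda>u v. (\<Sum>j\<in>UNIV. a j * wedge (dp j) (dx 1) u v)
            + (\<Sum>j\<in>UNIV. b j * wedge (dp j) (dx 2) u v)
            + c * wedge (dx 1) (dx 2) u v)" for c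
      using that coeff_eq unfolding coeff_eq[OF rep] by blast
  qed
  then show ?thesis by (simp add: z_def \<phi>_def \<psi>_def P_def Q_def)
qed

section \<open>The linear relation between the torsion coefficients\<close>

lemma differentiable_vec:
  fixes h :: "'a::real_normed_vector \<Rightarrow> real ^ 'm::finite"
  assumes "\<And>k. (\<lambda>y. h y $ k) differentiable (at a)"
  shows "h differentiable (at a)"
  using assms by (subst differentiable_componentwise_within) (auto simp: Basis_vec_def inner_axis)

lemma differentiable_frame:
  fixes f :: "real ^ (2 + 'q::finite)"
  assumes rho: "\<And>k. rho_d \<rho> k differentiable (at f)"
    and A: "\<And>j i. (\<lambda>y. A y $ j $ i) differentiable (at f)" and D: "D \<rho> A f \<noteq> 0"
  shows "D \<rho> A differentiable (at f)" and "frame \<rho> A j differentiable (at f)"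
    and "(\<lambda>y. A y *v frame \<rho> A j y) differentiable (at f)"
proof -
  have mu: "mu \<rho> A k differentiable (at f)" for k
    unfolding mu_def[abs_def] using rho A by (intro differentiable_sum differentiable_mult) auto
  show D': "D \<rho> A differentiable (at f)"
    unfolding D_def[abs_def] using rho mu by (intro differentiable_diff differentiable_mult) auto
  have g1: "gamma1 \<rho> A j differentiable (at f)" for j
    unfolding gamma1_def[abs_def] using rho mu D' D
    by (intro differentiable_diff differentiable_mult differentiable_minus differentiable_divide) auto
  have g2: "gamma2 \<rho> A j differentiable (at f)" for j
    unfolding gamma2_def[abs_def] using rho mu D' D
    by (intro differentiable_diff differentiable_mult differentiable_minus differentiable_divide) auto
  have frame: "(\<lambda>y. frame \<rho> A j y $ k) differentiable (at f)" for j k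
  proof (cases k)
    case (Inl a)
    then show ?thesis using g1 g2 by (cases "a = 1") (simp_all add: frame_def)
  qed simp
  then show "frame \<rho> A j differentiable (at f)" by (rule differentiable_vec)
  show "(\<lambda>y. A y *v frame \<rho> A j y) differentiable (at f)"
    by (rule differentiable_vec) (use A frame in
      \<open>auto simp: matrix_vector_mult_def intro!: differentiable_sum differentiable_mult\<close>)
qed

lemma derivative_of_annihilated:
  fixes r :: "'k::finite \<Rightarrow> 'a::real_normed_vector \<Rightarrow> real" and X :: "'a \<Rightarrow> real ^ 'k"
  assumes r: "\<And>k. (r k has_derivative r' k) (at a)" and X: "(X has_derivative X') (at a)"
    and zero: "\<forall>\<^sub>F y in nhds a. (\<Sum>k\<in>UNIV. r k y * X y $ k) = 0"
  shows "(\<Sum>k\<in>UNIV. r k a * X' h $ k) = - (\<Sum>k\<in>UNIV. r' k h * X a $ k)"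
proof -
  obtain U where U: "open U" "a \<in> U" "\<And>y. y \<in> U \<Longrightarrow> (\<Sum>k\<in>UNIV. r k y * X y $ k) = 0"
    using zero unfolding eventually_nhds by blast
  have "((\<lambda>y. \<Sum>k\<in>UNIV. r k y * X y $ k) has_derivative
      (\<lambda>h. \<Sum>k\<in>UNIV. r k a * X' h $ k + r' k h * X a $ k)) (at a)"
    by (intro has_derivative_sum has_derivative_mult r
        bounded_linear.has_derivative[OF bounded_linear_vec_nth] X)
  moreover have "((\<lambda>y. \<Sum>k\<in>UNIV. r k y * X y $ k) has_derivative (\<lambda>h. 0)) (at a)"
    by (rule has_derivative_transform_within_open[OF has_derivative_const U(1,2)]) (simp add: U(3))
  ultimately have "(\<lambda>h. \<Sum>k\<in>UNIV. r k a * X' h $ k + r' k h * X a $ k) = (\<lambda>h. 0)"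
    by (rule has_derivative_unique)
  from fun_cong[OF this, of h] show ?thesis by (simp add: sum.distrib)
qed

text \<open>
  The components of the identity \<open>d (d\<rho>) = 0\<close>. Differentiating \<open>\<nabla>\<rho> \<bullet> P = 0\<close> in the direction \<open>Q\<close>
  gives \<open>\<nabla>\<rho> \<bullet> DP(Q) = - H(P, Q)\<close>, differentiating \<open>\<nabla>\<rho> \<bullet> Q = 0\<close> in the direction \<open>P\<close> gives
  \<open>\<nabla>\<rho> \<bullet> DQ(P) = - H(Q, P)\<close>, and the difference vanishes by the symmetry of the Hessian \<open>H\<close>.
\<close>

lemma rho_torsion:
  fixes f :: "real ^ (2 + 'q::finite)"
  assumes H: "\<And>i j. H i j = H j i"
    and rho: "\<And>k. (rho_d \<rho> k has_derivative (\<lambda>h. \<Sum>i\<in>UNIV. h $ i * H k i)) (at f)"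
    and A: "\<And>j i. (\<lambda>y. A y $ j $ i) differentiable (at f)" and D: "D \<rho> A f \<noteq> 0"
  shows "(\<Sum>k\<in>UNIV. rho_d \<rho> k f * torsion \<rho> A k (x, f, p)) = 0"
proof -
  define W where "W = frame \<rho> A"
  define V where "V j y = A y *v frame \<rho> A j y" for j y
  note diff = differentiable_frame[OF differentiableI[OF rho] A D]
  have W: "(W j has_derivative frechet_derivative (W j) (at f)) (at f)"
    and V: "(V j has_derivative frechet_derivative (V j) (at f)) (at f)" for j
    using diff(2,3) by (simp_all add: W_def V_def[abs_def] frechet_derivative_works)
  define P where "P y = (\<Sum>j\<in>UNIV. p $ j *\<^sub>R W j y)" for y
  define Q where "Q y = (\<Sum>j\<in>UNIV. p $ j *\<^sub>R V j y)" for y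
  define P' where "P' h = (\<Sum>j\<in>UNIV. p $ j *\<^sub>R frechet_derivative (W j) (at f) h)" for h
  define Q' where "Q' h = (\<Sum>j\<in>UNIV. p $ j *\<^sub>R frechet_derivative (V j) (at f) h)" for h
  have PQ: "(P has_derivative P') (at f)" "(Q has_derivative Q') (at f)"
    unfolding P_def[abs_def] Q_def[abs_def] P'_def[abs_def] Q'_def[abs_def]
    by (intro has_derivative_sum has_derivative_scaleR_right W V)+
  have torsion: "torsion \<rho> A k (x, f, p) = P' (Q f) $ k - Q' (P f) $ k" for k
    by (subst torsion_eq_bracket[of \<rho> A W V, OF _ W V])
      (simp_all add: theta_eq W_def V_def P_def Q_def P'_def Q'_def)
  \<comment> \<open>The relations \<open>\<nabla>\<rho> \<bullet> P = 0\<close> and \<open>\<nabla>\<rho> \<bullet> Q = 0\<close> rest on \<open>D \<noteq> 0\<close>; to be differentiated they must hold around \<open>f\<close>.\<close>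
  have "isCont (D \<rho> A) f"
    using diff(1) by (rule differentiable_imp_continuous_within)
  then have near: "\<forall>\<^sub>F y in nhds f. D \<rho> A y \<noteq> 0"
    using D by (intro tendsto_imp_eventually_ne[of "D \<rho> A"])
      (simp_all add: isCont_def tendsto_at_iff_tendsto_nhds)
  have swap: "(\<Sum>k\<in>UNIV. rho_d \<rho> k y * (\<Sum>j\<in>UNIV. p $ j *\<^sub>R X j) $ k)
      = (\<Sum>j\<in>UNIV. p $ j * (\<Sum>k\<in>UNIV. rho_d \<rho> k y * X j $ k))" for y X
    by (simp add: sum_distrib_left mult.left_commute) (rule sum.swap)
  have zero: "\<forall>\<^sub>F y in nhds f. (\<Sum>k\<in>UNIV. rho_d \<rho> k y * P y $ k) = 0"
    "\<forall>\<^sub>F y in nhds f. (\<Sum>k\<in>UNIV. rho_d \<rho> k y * Q y $ k) = 0"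
    using near unfolding P_def Q_def W_def V_def
    by (auto elim!: eventually_mono simp only: swap rho_A)
      (simp_all add: rho_frame mu_frame)
  note annihilated = derivative_of_annihilated[OF rho PQ(1) zero(1)]
    derivative_of_annihilated[OF rho PQ(2) zero(2)]
  have "(\<Sum>k\<in>UNIV. rho_d \<rho> k f * torsion \<rho> A k (x, f, p))
      = (\<Sum>k\<in>UNIV. rho_d \<rho> k f * P' (Q f) $ k) - (\<Sum>k\<in>UNIV. rho_d \<rho> k f * Q' (P f) $ k)"
    by (simp add: torsion right_diff_distrib sum_subtractf)
  also have "\<dots> = (\<Sum>k\<in>UNIV. (\<Sum>i\<in>UNIV. P f $ i * H k i) * Q f $ k)
      - (\<Sum>k\<in>UNIV. (\<Sum>i\<in>UNIV. Q f $ i * H k i) * P f $ k)"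
    unfolding annihilated by simp
  also have "(\<Sum>k\<in>UNIV. (\<Sum>i\<in>UNIV. Q f $ i * H k i) * P f $ k)
      = (\<Sum>i\<in>UNIV. \<Sum>k\<in>UNIV. Q f $ i * H k i * P f $ k)"
    unfolding sum_distrib_right by (rule sum.swap)
  also have "\<dots> = (\<Sum>k\<in>UNIV. (\<Sum>i\<in>UNIV. P f $ i * H k i) * Q f $ k)"
    unfolding sum_distrib_right by (subst H) (simp add: mult_ac)
  finally show ?thesis by simp
qed

section \<open>Absorption of the torsion\<close>

text \<open>
  The vector \<open>v\<close> is \<open>v\<^sub>1\<close>, and \<open>v\<^sub>2\<close> is defined by solving the equations with index at least 3; the
  two hypotheses on the torsion are what remains of the other two equations, by \<open>beta_reduced\<close>.
\<close>

lemma torsion_absorbableI: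
  fixes \<rho> :: "real ^ (2 + 'q::finite) \<Rightarrow> real" and f :: "real ^ (2 + 'q)"
  assumes D: "D \<rho> A f \<noteq> 0"
    and 1: "torsion \<rho> A i1 (x, f, p) - (\<Sum>i\<in>UNIV. gamma1 \<rho> A i f * torsion \<rho> A (Inr i) (x, f, p))
      = rho_d \<rho> i2 f * (\<Sum>i\<in>UNIV. D0 \<rho> A f $ i * v i)"
    and 2: "torsion \<rho> A i2 (x, f, p) - (\<Sum>i\<in>UNIV. gamma2 \<rho> A i f * torsion \<rho> A (Inr i) (x, f, p))
      = - rho_d \<rho> i1 f * (\<Sum>i\<in>UNIV. D0 \<rho> A f $ i * v i)"
  shows "torsion_absorbable \<rho> A (x, f, p)"
proof -
  define c where "c k = torsion \<rho> A k (x, f, p)" for k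
  define v2 where "v2 j = c (Inr j) + (\<Sum>i\<in>UNIV. beta \<rho> A (Inr j) i f * v i)" for j
  have eliminate: "(\<Sum>i\<in>UNIV. g i * v2 i - b i * v i)
      = (\<Sum>i\<in>UNIV. g i * c (Inr i))
        + (\<Sum>j\<in>UNIV. ((\<Sum>i\<in>UNIV. g i * beta \<rho> A (Inr i) j f) - b j) * v j)" for g b
  proof -
    have "(\<Sum>i\<in>UNIV. g i * (\<Sum>j\<in>UNIV. beta \<rho> A (Inr i) j f * v j))
        = (\<Sum>j\<in>UNIV. (\<Sum>i\<in>UNIV. g i * beta \<rho> A (Inr i) j f) * v j)"
      unfolding sum_distrib_left sum_distrib_right mult.assoc by (rule sum.swap)
    then show ?thesis
      by (simp add: v2_def distrib_left left_diff_distrib sum.distrib sum_subtractf)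
  qed
  have "(\<Sum>i\<in>UNIV. gamma1 \<rho> A i f * v2 i - beta \<rho> A i1 i f * v i) = c i1"
    "(\<Sum>i\<in>UNIV. gamma2 \<rho> A i f * v2 i - beta \<rho> A i2 i f * v i) = c i2"
    unfolding eliminate beta_reduced[OF D] mult.assoc sum_distrib_left[symmetric]
    using 1 2 by (simp_all add: c_def)
  moreover have "\<forall>j. v2 j - (\<Sum>i\<in>UNIV. beta \<rho> A (Inr j) i f * v i) = c (Inr j)"
    by (simp add: v2_def)
  ultimately show ?thesis
    unfolding torsion_absorbable_def Let_def c_def fst_conv snd_conv by blast
qed

theorem theorem3p5:
  fixes n :: nat
    and \<rho> :: "real ^ (2 + 'q::finite) \<Rightarrow> real"
    and A :: "real ^ (2 + 'q) \<Rightarrow> real ^ (2 + 'q) ^ (2 + 'q)"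
    and \<Omega> :: "(real ^ 2) set"
    and \<Omega>t :: "(real ^ (2 + 'q)) set"
    and x :: "real ^ 2" and f :: "real ^ (2 + 'q)" and p :: "real ^ 'q"
  assumes "n \<ge> 2" and "CARD('q) + 2 = 2 * n"
    and "open \<Omega>" and "open \<Omega>t"
    and "real_analytic_on \<rho> \<Omega>t"
    and "\<And>j i. real_analytic_on (\<lambda>y. A y $ j $ i) \<Omega>t"
    and "(x, f, p) \<in> M_space \<rho> A \<Omega> \<Omega>t"
  shows
    "(D0 \<rho> A f \<noteq> 0 \<longrightarrow>
       rho_d \<rho> i1 f * (torsion \<rho> A i1 (x, f, p)
          - (\<Sum>i\<in>UNIV. gamma1 \<rho> A i f * torsion \<rho> A (Inr i) (x, f, p)))
       = rho_d \<rho> i2 f * (torsion \<rho> A i2 (x, f, p)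
          - (\<Sum>i\<in>UNIV. gamma2 \<rho> A i f * torsion \<rho> A (Inr i) (x, f, p)))
       \<longrightarrow> torsion_absorbable \<rho> A (x, f, p)) \<and>
     (D0 \<rho> A f = 0 \<longrightarrow>
       torsion \<rho> A i1 (x, f, p) = (\<Sum>i\<in>UNIV. gamma1 \<rho> A i f * torsion \<rho> A (Inr i) (x, f, p)) \<and>
       torsion \<rho> A i2 (x, f, p) = (\<Sum>i\<in>UNIV. gamma2 \<rho> A i f * torsion \<rho> A (Inr i) (x, f, p))
       \<longrightarrow> torsion_absorbable \<rho> A (x, f, p))"
proof -
  define c where "c k = torsion \<rho> A k (x, f, p)" for k
  define C1 where "C1 = c i1 - (\<Sum>i\<in>UNIV. gamma1 \<rho> A i f * c (Inr i))"
  define C2 where "C2 = c i2 - (\<Sum>i\<in>UNIV. gamma2 \<rho> A i f * c (Inr i))"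
  define r1 where "r1 = rho_d \<rho> i1 f"
  define r2 where "r2 = rho_d \<rho> i2 f"
  have f: "f \<in> \<Omega>t" and D: "D \<rho> A f \<noteq> 0"
    using assms(7) by (auto simp: M_space_def)
  have rho_d: "rho_d \<rho> k = partial_deriv k \<rho>" for k
    by (simp add: rho_d_def fun_eq_iff)
  obtain H where H: "\<And>i j. H i j = H j i"
    and rho: "\<And>k. (rho_d \<rho> k has_derivative (\<lambda>h. \<Sum>i\<in>UNIV. h $ i * H k i)) (at f)"
    using real_analytic_has_derivative(2)[OF assms(5) f] unfolding rho_d by blast
  have A: "(\<lambda>y. A y $ j $ i) differentiable (at f)" for j i
    using real_analytic_has_derivative(1)[OF assms(6) f] by (rule differentiableI)
  have compat: "r1 * C1 + r2 * C2 = 0"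
    using rho_torsion[OF H rho A D, of x p]
      pairing_of_annihilator[OF rho_frame[OF D], of "\<lambda>k. torsion \<rho> A k (x, f, p)"]
    by (simp add: C1_def C2_def c_def r1_def r2_def)
  have "r1 \<noteq> 0 \<or> r2 \<noteq> 0"
    using D by (auto simp: D_def r1_def r2_def)
  then have pos: "r1\<^sup>2 + r2\<^sup>2 \<noteq> 0"
    by (simp add: sum_power2_eq_zero_iff)
  \<comment> \<open>\<open>(C1, C2)\<close> is orthogonal to \<open>(r1, r2)\<close>, hence equal to its projection to the line of \<open>(r2, - r1)\<close>.\<close>
  define t where "t = (r2 * C1 - r1 * C2) / (r1\<^sup>2 + r2\<^sup>2)"
  have t: "C1 = r2 * t" "C2 = - r1 * t"
  proof -
    have "(r1\<^sup>2 + r2\<^sup>2) * t = r2 * C1 - r1 * C2" using pos by (simp add: t_def)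
    then have "(r1\<^sup>2 + r2\<^sup>2) * C1 = (r1\<^sup>2 + r2\<^sup>2) * (r2 * t)"
      "(r1\<^sup>2 + r2\<^sup>2) * C2 = (r1\<^sup>2 + r2\<^sup>2) * (- r1 * t)"
      using compat by algebra+
    then show "C1 = r2 * t" "C2 = - r1 * t"
      unfolding mult_left_cancel[OF pos] by this
  qed
  have absorb: "torsion_absorbable \<rho> A (x, f, p)"
    if "C1 = r2 * (\<Sum>i\<in>UNIV. D0 \<rho> A f $ i * v i)"
      "C2 = - r1 * (\<Sum>i\<in>UNIV. D0 \<rho> A f $ i * v i)" for v
    using torsion_absorbableI[OF D, of x p v] that by (simp add: C1_def C2_def r1_def r2_def c_def)
  show ?thesis
  proof (intro conjI impI)
    \<comment> \<open>A multiple of \<open>D0\<close> itself serves as \<open>v\<^sub>1\<close>, since pairing it with \<open>D0\<close> reaches every real number.\<close>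
    assume "D0 \<rho> A f \<noteq> 0"
    moreover define N where "N = D0 \<rho> A f \<bullet> D0 \<rho> A f"
    ultimately have "N \<noteq> 0" by simp
    have "(\<Sum>i\<in>UNIV. D0 \<rho> A f $ i * (t / N * D0 \<rho> A f $ i)) = t / N * N"
      by (subst (2) N_def) (simp add: inner_vec_def sum_distrib_left mult_ac)
    with \<open>N \<noteq> 0\<close> have "(\<Sum>i\<in>UNIV. D0 \<rho> A f $ i * (t / N * D0 \<rho> A f $ i)) = t" by simp
    with t show "torsion_absorbable \<rho> A (x, f, p)"
      by (intro absorb[of "\<lambda>i. t / N * D0 \<rho> A f $ i"]) (simp_all only:)
  next
    assume "D0 \<rho> A f = 0"
      and "torsion \<rho> A i1 (x, f, p) = (\<Sum>i\<in>UNIV. gamma1 \<rho> A i f * torsion \<rho> A (Inr i) (x, f, p)) \<and>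
       torsion \<rho> A i2 (x, f, p) = (\<Sum>i\<in>UNIV. gamma2 \<rho> A i f * torsion \<rho> A (Inr i) (x, f, p))"
    then show "torsion_absorbable \<rho> A (x, f, p)"
      by (intro absorb[of "\<lambda>_. 0"]) (simp_all add: C1_def C2_def c_def)
  qed
qed

end
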